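(* Let $G$ be a group with a finite generating set $X$. Then (i) $(G,X)$ has the asynchronous loop shortening property if and only if $(G,X)$ has the (synchronous) loop shortening property; and (ii) $(G,X)$ has the asynchronous basepoint loop shortening property if and only if $(G,X)$ has the (synchronous) basepoint loop shortening property.
   Context: $X^*$ denotes the set of all words in the letters of $X$ and their inverses, including the empty word, and $\Gamma(G,X)$ is the Cayley graph, a metric graph with edges of length $1$ and path metric $d$. A word $w\in X^*$ together with a starting vertex determines a path in $\Gamma(G,X)$ (called a path in $(G,X)$), of length $|w|$ equal to the number of letters. A loop is a path which starts and ends at the same vertex; it is based at that vertex. A path or loop $w$ is parameterized by arc length: $w(t)$ is the point at distance $t$ along $w$ from its start point for $0\le t\le |w|$, and $w(t)$ is the endpoint of $w$ for $t>|w|$. Two paths (or loops) $w,u$, possibly with distinct start and end points, $k$-fellow travel if $d(w(t),u(t))\le k$ for all real $t\ge 0$. They asynchronously $k$-fellow travel if there is a proper monotone increasing function $\phi:\mathbb{R}_{\ge 0}\to\mathbb{R}_{\ge 0}$ such that $d(w(t),u(\phi(t)))\le k$ for all $t\ge 0$. $(G,X)$ has the [asynchronous] loop shortening property if there is a constant $k>0$ such that for each loop $w$ in $(G,X)$ of positive length there is a loop $u$ in $(G,X)$ with $|u|<|w|$ such that $w,u$ [asynchronously] $k$-fellow travel ($u$ and $w$ may be disjoint and have different basepoints). $(G,X)$ has the [asynchronous] basepoint loop shortening property if there is a constant $k>0$ such that for each loop $w$ in $(G,X)$ of positive length, based at $w(0)$, there is a loop $u$ in $(G,X)$ based at $w(0)$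 with $|u|<|w|$ such that $w,u$ [asynchronously] $k$-fellow travel. *)

theory Defs
  imports "HOL-Algebra.Generated_Groups" "HOL-Analysis.Analysis"
begin

section \<open>Words and paths\<close>

text \<open>The letter \<open>(x, True)\<close> is \<open>x\<close> and \<open>(x, False)\<close> is the formal inverse of \<open>x\<close>; words are
  not reduced.  A path is a starting vertex together with a word.\<close>

type_synonym 'a word = "('a \<times> bool) list"
type_synonym 'a cpath = "'a \<times> 'a word"

definition words :: "'a set \<Rightarrow> 'a word set" where
  "words X = lists (X \<times> UNIV)"

definition letter_val :: "('a, 'b) monoid_scheme \<Rightarrow> 'a \<times> bool \<Rightarrow> 'a" where
  "letter_val G l = (if snd l then fst l else inv\<^bsub>G\<^esub> (fst l))"

definition end_vertex :: "('a, 'b) monoid_scheme \<Rightarrow> 'a cpath \<Rightarrow> 'a" where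
  "end_vertex G p = foldl (\<lambda>g l. g \<otimes>\<^bsub>G\<^esub> letter_val G l) (fst p) (snd p)"

definition plength :: "'a cpath \<Rightarrow> nat" where
  "plength p = length (snd p)"

definition cpaths :: "('a, 'b) monoid_scheme \<Rightarrow> 'a set \<Rightarrow> 'a cpath set" where
  "cpaths G X = carrier G \<times> words X"

definition cloops :: "('a, 'b) monoid_scheme \<Rightarrow> 'a set \<Rightarrow> 'a cpath set" where
  "cloops G X = {p \<in> cpaths G X. end_vertex G p = fst p}"

section \<open>The Cayley graph as a metric graph\<close>

text \<open>For every \<open>g \<in> carrier G\<close> and \<open>x \<in> X\<close> there is one edge, from \<open>g\<close> to \<open>g \<otimes> x\<close>.
  \<open>Inner g x s\<close> with \<open>0 < s < 1\<close> is the point of its interior at distance \<open>s\<close> from \<open>g\<close> along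
  the edge.\<close>

datatype 'a cpoint = Vertex 'a | Inner 'a 'a real

definition edge_point :: "('a, 'b) monoid_scheme \<Rightarrow> 'a \<Rightarrow> 'a \<Rightarrow> real \<Rightarrow> 'a cpoint" where
  "edge_point G g x s =
     (if s = 0 then Vertex g else if s = 1 then Vertex (g \<otimes>\<^bsub>G\<^esub> x) else Inner g x s)"

definition cayley_points :: "('a, 'b) monoid_scheme \<Rightarrow> 'a set \<Rightarrow> 'a cpoint set" where
  "cayley_points G X =
     Vertex ` carrier G \<union> {edge_point G g x s |g x s. g \<in> carrier G \<and> x \<in> X \<and> s \<in> {0..1}}"

text \<open>\<open>pl_path G X p r q\<close>: some piecewise linear path of length \<open>r\<close> joins \<open>p\<close> to \<open>q\<close>, i.e. a finite
  concatenation of segments each contained in a single closed edge.\<close>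

inductive pl_path ::
  "('a, 'b) monoid_scheme \<Rightarrow> 'a set \<Rightarrow> 'a cpoint \<Rightarrow> real \<Rightarrow> 'a cpoint \<Rightarrow> bool"
  for G :: "('a, 'b) monoid_scheme" and X :: "'a set" and p :: "'a cpoint" where
  start: "p \<in> cayley_points G X \<Longrightarrow> pl_path G X p 0 p"
| segment: "pl_path G X p r (edge_point G g x s) \<Longrightarrow> g \<in> carrier G \<Longrightarrow> x \<in> X \<Longrightarrow>
    s \<in> {0..1} \<Longrightarrow> t \<in> {0..1} \<Longrightarrow> pl_path G X p (r + \<bar>t - s\<bar>) (edge_point G g x t)"

text \<open>The infimum is over a nonempty set as soon as \<open>X\<close> generates \<open>G\<close>.\<close>

definition cayley_dist :: "('a, 'b) monoid_scheme \<Rightarrow> 'a set \<Rightarrow> 'a cpoint \<Rightarrow> 'a cpoint \<Rightarrow> real" where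
  "cayley_dist G X p q = Inf {r. pl_path G X p r q}"

text \<open>Arc length parameterization, for times \<open>t \<ge> 0\<close>.  An inverse letter \<open>(x, False)\<close> read at the
  vertex \<open>v\<close> traverses the edge from \<open>v \<otimes> inv x\<close> to \<open>v\<close> backwards.\<close>

definition path_at :: "('a, 'b) monoid_scheme \<Rightarrow> 'a cpath \<Rightarrow> real \<Rightarrow> 'a cpoint" where
  "path_at G p t =
     (if t < real (plength p) then
        (let i = nat \<lfloor>t\<rfloor>; s = t - real i;
             v = end_vertex G (fst p, take i (snd p)); (x, e) = snd p ! i
         in if e then edge_point G v x s else edge_point G (v \<otimes>\<^bsub>G\<^esub> inv\<^bsub>G\<^esub> x) x (1 - s))
      else Vertex (end_vertex G p))"

section \<open>Fellow travelling and loop shortening\<close>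

definition fellow_travel ::
  "('a, 'b) monoid_scheme \<Rightarrow> 'a set \<Rightarrow> real \<Rightarrow> 'a cpath \<Rightarrow> 'a cpath \<Rightarrow> bool" where
  "fellow_travel G X k w u \<longleftrightarrow>
     (\<forall>t\<ge>0. cayley_dist G X (path_at G w t) (path_at G u t) \<le> k)"

text \<open>\<^const>\<open>proper_map\<close> does not ask for continuity, but a monotone map which is proper in this sense
  is continuous, since a jump would give a non-closed image or a non-compact fibre.\<close>

definition async_fellow_travel ::
  "('a, 'b) monoid_scheme \<Rightarrow> 'a set \<Rightarrow> real \<Rightarrow> 'a cpath \<Rightarrow> 'a cpath \<Rightarrow> bool" where
  "async_fellow_travel G X k w u \<longleftrightarrow>
     (\<exists>\<phi> :: real \<Rightarrow> real. \<phi> \<in> {0..} \<rightarrow> {0..} \<and> mono_on {0..} \<phi> \<and>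
        proper_map (top_of_set {0..}) (top_of_set {0..}) \<phi> \<and>
        (\<forall>t\<ge>0. cayley_dist G X (path_at G w t) (path_at G u (\<phi> t)) \<le> k))"

definition loop_shortening :: "('a, 'b) monoid_scheme \<Rightarrow> 'a set \<Rightarrow> bool" where
  "loop_shortening G X \<longleftrightarrow>
     (\<exists>k>0. \<forall>w\<in>cloops G X. plength w > 0 \<longrightarrow>
        (\<exists>u\<in>cloops G X. plength u < plength w \<and> fellow_travel G X k w u))"

definition async_loop_shortening :: "('a, 'b) monoid_scheme \<Rightarrow> 'a set \<Rightarrow> bool" where
  "async_loop_shortening G X \<longleftrightarrow>
     (\<exists>k>0. \<forall>w\<in>cloops G X. plength w > 0 \<longrightarrow>
        (\<exists>u\<in>cloops G X. plength u < plength w \<and> async_fellow_travel G X k w u))"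

definition basepoint_loop_shortening :: "('a, 'b) monoid_scheme \<Rightarrow> 'a set \<Rightarrow> bool" where
  "basepoint_loop_shortening G X \<longleftrightarrow>
     (\<exists>k>0. \<forall>w\<in>cloops G X. plength w > 0 \<longrightarrow>
        (\<exists>u\<in>cloops G X. fst u = fst w \<and> plength u < plength w \<and> fellow_travel G X k w u))"

definition async_basepoint_loop_shortening :: "('a, 'b) monoid_scheme \<Rightarrow> 'a set \<Rightarrow> bool" where
  "async_basepoint_loop_shortening G X \<longleftrightarrow>
     (\<exists>k>0. \<forall>w\<in>cloops G X. plength w > 0 \<longrightarrow>
        (\<exists>u\<in>cloops G X. fst u = fst w \<and> plength u < plength w \<and>
           async_fellow_travel G X k w u))"

end

theory Submission imports Defs begin

text \<open>
  Only the passage from asynchronous to synchronous fellow travelling needs an argument; in the other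
  direction the identity is an admissible reparameterization.

  Let \<open>w\<close> be a loop of length \<open>n\<close> and \<open>u\<close> a loop of length \<open>m < n\<close> such that the point
  \<open>u(\<phi>(t))\<close> is always close to \<open>w(t)\<close>.  Rounding \<open>\<phi>\<close> down and cutting it off at \<open>m\<close> yields a monotone
  \<open>f : {0..n} \<rightarrow> {0..m}\<close> such that, for a constant \<open>B\<close>, the \<open>i\<close>-th vertex of \<open>w\<close> and the \<open>f(i)\<close>-th
  vertex of \<open>u\<close> are joined by a path of at most \<open>B\<close> edges (a bridge).  Fix \<open>C = 2B + 1\<close> and look at the
  drift \<open>f(i) - i\<close>.

  If the drift never drops by \<open>C\<close> or more between two times, then it is always bounded by \<open>C\<close> in absolute
  value, because it is nonnegative at time \<open>0\<close> and negative at time \<open>n\<close>.  So \<open>u\<close> already travels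
  synchronously with \<open>w\<close>.

  Otherwise take a shortest interval \<open>[s, t]\<close> on which the drift drops by \<open>C\<close> or more.  It drops by
  exactly \<open>C\<close> there, and in between it differs from its value at \<open>s\<close> by at most \<open>C\<close>
  (\<open>drift_dichotomy\<close>).  Follow \<open>w\<close> up to time \<open>s\<close>, cross a bridge to \<open>u\<close>, follow \<open>u\<close> from \<open>f(s)\<close> to
  \<open>f(t)\<close>, cross a bridge back and follow \<open>w\<close> from time \<open>t\<close> on.  The detour through \<open>u\<close> saves \<open>C\<close> edges
  and the bridges cost at most \<open>2B\<close>, so this loop is shorter than \<open>w\<close>; it has the basepoint of \<open>w\<close>, and
  the bound on the drift makes it travel synchronously with \<open>w\<close> (\<open>shortcut_loop\<close>).

  In both cases the new loop is based at the basepoint of \<open>u\<close> or of \<open>w\<close>, so the same construction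
  serves both versions of the property.
\<close>

section \<open>The drift of a monotone reparameterization\<close>

text \<open>The drift at time \<open>i\<close> is \<open>f i - i\<close>; all inequalities are rearranged so as to avoid subtraction.
  The drift drops by at most \<open>1\<close> per step, since \<open>f\<close> is monotone, and therefore a shortest interval on
  which it drops by at least \<open>C\<close> has a drop of exactly \<open>C\<close>.\<close>

lemma drift_dichotomy:
  fixes f :: "nat \<Rightarrow> nat" and C n :: nat
  assumes mono: "\<And>i j. i \<le> j \<Longrightarrow> f i \<le> f j" and "C > 0"
  obtains
    (bounded) "\<And>s t. s \<le> t \<Longrightarrow> t \<le> n \<Longrightarrow> t + f s \<le> s + f t + C"
  | (drop) s t where "s \<le> t" "t \<le> n" "t + f s = s + f t + C"
      "\<And>i. s \<le> i \<Longrightarrow> i \<le> t \<Longrightarrow> i + f s \<le> s + f i + C \<and> s + f i \<le> i + f s"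
proof (cases "\<exists>s t. s \<le> t \<and> t \<le> n \<and> s + f t + C \<le> t + f s")
  case False
  then show ?thesis using bounded by (meson nle_le)
next
  case True
  define P where "P = (\<lambda>(s, t). s \<le> t \<and> t \<le> n \<and> s + f t + C \<le> t + f s)"
  from True have "\<exists>p. P p" by (auto simp: P_def)
  then obtain p where p: "P p" "\<And>q. P q \<Longrightarrow> snd p - fst p \<le> snd q - fst q"
    using ex_has_least_nat[of P _ "\<lambda>p. snd p - fst p"] by blast
  obtain s t where [simp]: "p = (s, t)" by force
  have st: "s \<le> t" "t \<le> n" "s + f t + C \<le> t + f s" using p(1) by (auto simp: P_def)
  have least: "i' + f j < j + f i' + C \<or> t - s \<le> i' - j" if "j \<le> i'" "i' \<le> n" for i' j
    using p(2)[of "(j, i')"] that by (simp add: P_def) linarith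
  have "s < t" using st \<open>C > 0\<close> by (cases "s = t") auto
  \<comment> \<open>\<open>[s, t - 1]\<close> is shorter, so its drop is less than \<open>C\<close>\<close>
  then have "t - 1 + f s < s + f (t - 1) + C" using least[of s "t - 1"] st by arith
  moreover have "f (t - 1) \<le> f t" by (rule mono) auto
  ultimately have eq: "t + f s = s + f t + C" using st by linarith
  show ?thesis
  proof (rule drop[OF st(1,2) eq])
    fix i assume i: "s \<le> i" "i \<le> t"
    have "i + f s \<le> s + f i + C"
      using least[of s i] i st eq by (cases "i = t") arith+
    moreover have "t + f i \<le> i + f t + C"
      using least[of i t] i st eq by (cases "i = s") arith+
    ultimately show "i + f s \<le> s + f i + C \<and> s + f i \<le> i + f s" using eq by linarith
  qed
qed

section \<open>Words, paths and their vertices\<close>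

definition path_vertex :: "('a, 'b) monoid_scheme \<Rightarrow> 'a cpath \<Rightarrow> nat \<Rightarrow> 'a" where
  "path_vertex G p i = end_vertex G (fst p, take i (snd p))"

lemma end_vertex_append:
  "end_vertex G (g, xs @ ys) = end_vertex G (end_vertex G (g, xs), ys)"
  by (simp add: end_vertex_def)

lemma end_vertex_Nil [simp]: "end_vertex G (g, []) = g"
  by (simp add: end_vertex_def)

lemma path_vertex_end: "plength p \<le> i \<Longrightarrow> path_vertex G p i = end_vertex G p"
  by (simp add: path_vertex_def plength_def)

lemma path_vertex_append_left:
  "i \<le> length xs \<Longrightarrow> path_vertex G (g, xs @ ys) i = path_vertex G (g, xs) i"
  by (simp add: path_vertex_def)

lemma path_vertex_append_right:
  "path_vertex G (g, xs @ ys) (length xs + j) = path_vertex G (end_vertex G (g, xs), ys) j"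
  by (simp add: path_vertex_def end_vertex_append)

lemma path_vertex_take:
  "i \<le> j \<Longrightarrow> path_vertex G (g, take j xs) i = path_vertex G (g, xs) i"
  by (simp add: path_vertex_def min_def)

lemma path_vertex_drop:
  "path_vertex G (path_vertex G (g, xs) j, drop j xs) i = path_vertex G (g, xs) (j + i)"
  by (simp add: path_vertex_def take_add flip: end_vertex_append)

lemma words_append [simp]: "xs @ ys \<in> words X \<longleftrightarrow> xs \<in> words X \<and> ys \<in> words X"
  by (auto simp: words_def)

lemma words_Nil [simp]: "[] \<in> words X"
  by (simp add: words_def)

lemma words_take: "xs \<in> words X \<Longrightarrow> take i xs \<in> words X"
  and words_drop: "xs \<in> words X \<Longrightarrow> drop i xs \<in> words X"
  by (metis append_take_drop_id words_append)+

locale cayley_graph = group G for G :: "('a, 'b) monoid_scheme" (structure) +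
  fixes X :: "'a set"
  assumes X_subset: "X \<subseteq> carrier G" and generate_X: "generate G X = carrier G"
begin

lemma letter_val_closed: "l \<in> X \<times> UNIV \<Longrightarrow> letter_val G l \<in> carrier G"
  using X_subset by (auto simp: letter_val_def)

lemma end_vertex_closed: "g \<in> carrier G \<Longrightarrow> w \<in> words X \<Longrightarrow> end_vertex G (g, w) \<in> carrier G"
proof (induction w arbitrary: g)
  case (Cons l w)
  then show ?case
    using letter_val_closed[of l] end_vertex_append[of G g "[l]" w]
    by (auto simp: words_def end_vertex_def)
qed simp

lemma path_vertex_closed: "p \<in> cpaths G X \<Longrightarrow> path_vertex G p i \<in> carrier G"
  by (auto simp: cpaths_def path_vertex_def intro!: end_vertex_closed words_take)

lemma end_vertex_mult:
  assumes "g \<in> carrier G" "h \<in> carrier G" "w \<in> words X"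
  shows "end_vertex G (g \<otimes> h, w) = g \<otimes> end_vertex G (h, w)"
  using assms
proof (induction w arbitrary: h)
  case (Cons l w)
  then show ?case
    using letter_val_closed[of l] end_vertex_append[of G _ "[l]" w]
    by (auto simp: words_def end_vertex_def m_assoc)
qed simp

lemma generators_connect:
  assumes "h \<in> carrier G"
  obtains w where "w \<in> words X" "end_vertex G (\<one>, w) = h"
proof -
  have "h \<in> generate G X" using assms generate_X by simp
  then have "\<exists>w\<in>words X. end_vertex G (\<one>, w) = h"
  proof (induction rule: generate.induct)
    case one
    show ?case by (auto intro!: bexI[of _ "[]"])
  next
    case (incl x)
    then show ?case using X_subset
      by (auto intro!: bexI[of _ "[(x, True)]"] simp: words_def end_vertex_def letter_val_def)
  next
    case (inv x)
    then show ?case using X_subset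
      by (auto intro!: bexI[of _ "[(x, False)]"] simp: words_def end_vertex_def letter_val_def)
  next
    case (eng g h)
    then obtain v w where "v \<in> words X" "end_vertex G (\<one>, v) = g" "w \<in> words X"
      "end_vertex G (\<one>, w) = h" by blast
    moreover have "g \<in> carrier G" using eng generate_X by auto
    ultimately show ?case using end_vertex_mult[of g \<one> w]
      by (auto intro!: bexI[of _ "v @ w"] simp: end_vertex_append)
  qed
  then show thesis using that by blast
qed

section \<open>The metric of the Cayley graph\<close>

abbreviation "points \<equiv> cayley_points G X"
abbreviation "cdist \<equiv> cayley_dist G X"

lemma edge_point_in_points:
  "g \<in> carrier G \<Longrightarrow> x \<in> X \<Longrightarrow> s \<in> {0..1} \<Longrightarrow> edge_point G g x s \<in> points"
  by (auto simp: cayley_points_def)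

lemma Vertex_in_points: "g \<in> carrier G \<Longrightarrow> Vertex g \<in> points"
  by (simp add: cayley_points_def)

lemma pl_path_trans: "pl_path G X q r' z \<Longrightarrow> pl_path G X p r q \<Longrightarrow> pl_path G X p (r + r') z"
proof (induction rule: pl_path.induct)
  case (segment r' g x s t)
  then show ?case
    using pl_path.segment[of G X p "r + r'" g x s t] by (simp add: add.assoc)
qed simp

lemma pl_path_edge:
  assumes "g \<in> carrier G" "x \<in> X" "s \<in> {0..1}" "t \<in> {0..1}"
  shows "pl_path G X (edge_point G g x s) \<bar>t - s\<bar> (edge_point G g x t)"
  using pl_path.segment[OF pl_path.start, of G g x s X t] assms edge_point_in_points by simp

lemma pl_path_sym: "pl_path G X p r q \<Longrightarrow> pl_path G X q r p"
proof (induction rule: pl_path.induct)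
  case start
  then show ?case by (rule pl_path.start)
next
  case (segment r g x s t)
  have "pl_path G X (edge_point G g x t) \<bar>s - t\<bar> (edge_point G g x s)"
    using segment by (intro pl_path_edge)
  from pl_path_trans[OF segment(6) this] show ?case
    by (simp add: abs_minus_commute add.commute)
qed

lemma pl_path_nonneg: "pl_path G X p r q \<Longrightarrow> 0 \<le> r"
  by (induction rule: pl_path.induct) auto

lemma cdist_le: "pl_path G X p r q \<Longrightarrow> cdist p q \<le> r"
  unfolding cayley_dist_def
  by (rule cInf_lower) (auto intro!: bdd_belowI[of _ 0] pl_path_nonneg)

lemma cdist_sym: "cdist p q = cdist q p"
  unfolding cayley_dist_def by (metis pl_path_sym)

lemma pl_path_letter:
  assumes "g \<in> carrier G" "l \<in> X \<times> UNIV"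
  shows "pl_path G X (Vertex g) 1 (Vertex (g \<otimes> letter_val G l))"
proof -
  obtain x e where l: "l = (x, e)" "x \<in> X" using assms by auto
  then have x: "x \<in> carrier G" using X_subset by auto
  have edge: "pl_path G X (Vertex h) 1 (Vertex (h \<otimes> x))" if "h \<in> carrier G" for h
    using pl_path_edge[of h x 0 1] that l by (simp add: edge_point_def)
  show ?thesis
  proof (cases e)
    case True
    then show ?thesis using edge[OF assms(1)] l by (simp add: letter_val_def)
  next
    case False
    then show ?thesis using pl_path_sym[OF edge[of "g \<otimes> inv x"]] l assms x
      by (simp add: letter_val_def m_assoc)
  qed
qed

lemma pl_path_word:
  "g \<in> carrier G \<Longrightarrow> w \<in> words X \<Longrightarrow> pl_path G X (Vertex g) (length w) (Vertex (end_vertex G (g, w)))"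
proof (induction w rule: rev_induct)
  case Nil
  then show ?case by (auto intro!: pl_path.start Vertex_in_points)
next
  case (snoc l w)
  then have "pl_path G X (Vertex (end_vertex G (g, w))) 1
      (Vertex (end_vertex G (g, w) \<otimes> letter_val G l))"
    by (intro pl_path_letter end_vertex_closed) (auto simp: words_def)
  moreover have "pl_path G X (Vertex g) (length w) (Vertex (end_vertex G (g, w)))"
    using snoc by simp
  ultimately have "pl_path G X (Vertex g) (real (length w) + 1)
      (Vertex (end_vertex G (g, w) \<otimes> letter_val G l))"
    using pl_path_trans by blast
  then show ?case by (simp add: end_vertex_append) (simp add: end_vertex_def add.commute)
qed

lemma pl_path_exists:
  assumes "p \<in> points" "q \<in> points"
  obtains r where "pl_path G X p r q"
proof -
  have from_one: "\<exists>r. pl_path G X (Vertex \<one>) r z" if z: "z \<in> points" for z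
  proof -
    have vertex: "\<exists>r. pl_path G X (Vertex \<one>) r (Vertex h)" if "h \<in> carrier G" for h
      using generators_connect[OF that] pl_path_word[of \<one>] by (metis one_closed)
    show ?thesis
    proof (cases "z \<in> Vertex ` carrier G")
      case True
      then show ?thesis using vertex by auto
    next
      case False
      then obtain g x s where gxs: "z = edge_point G g x s" "g \<in> carrier G" "x \<in> X" "s \<in> {0..1}"
        using z by (auto simp: cayley_points_def)
      from vertex[OF gxs(2)] obtain r where "pl_path G X (Vertex \<one>) r (edge_point G g x 0)"
        by (auto simp: edge_point_def)
      from pl_path.segment[OF this gxs(2,3) _ gxs(4)] gxs(1) show ?thesis by auto
    qed
  qed
  from from_one[OF assms(1)] from_one[OF assms(2)] that show thesis
    by (meson pl_path_trans pl_path_sym)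
qed

lemma pl_path_near_cdist:
  assumes "p \<in> points" "q \<in> points" "e > 0"
  obtains r where "pl_path G X p r q" "r < cdist p q + e"
proof -
  have "{r. pl_path G X p r q} \<noteq> {}" using pl_path_exists[OF assms(1,2)] by blast
  from cInf_lessD[OF this, of "cdist p q + e"] show thesis
    using assms(3) that by (auto simp: cayley_dist_def)
qed

lemma cdist_triangle:
  assumes "p \<in> points" "q \<in> points" "z \<in> points"
  shows "cdist p z \<le> cdist p q + cdist q z"
proof (rule field_le_epsilon)
  fix e :: real assume "e > 0"
  then have "e / 2 > 0" by simp
  obtain r where r: "pl_path G X p r q" "r < cdist p q + e / 2"
    using pl_path_near_cdist[OF assms(1,2) \<open>e / 2 > 0\<close>] .
  obtain r' where r': "pl_path G X q r' z" "r' < cdist q z + e / 2"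
    using pl_path_near_cdist[OF assms(2,3) \<open>e / 2 > 0\<close>] .
  show "cdist p z \<le> cdist p q + cdist q z + e"
    using cdist_le[OF pl_path_trans[OF r'(1) r(1)]] r(2) r'(2) by linarith
qed

text \<open>A piecewise linear path may turn back inside an edge, so it is not a word with a rounding error.
  What survives induction along the path is a comparison of its length with the two ways of reaching
  the current point: through the initial vertex or through the final vertex of the edge carrying it.\<close>

definition reachable_vertex :: "'a \<Rightarrow> real \<Rightarrow> 'a \<Rightarrow> bool" where
  "reachable_vertex g r h \<longleftrightarrow> (\<exists>w\<in>words X. end_vertex G (g, w) = h \<and> real (length w) \<le> r)"

definition reachable_on_edge :: "'a \<Rightarrow> real \<Rightarrow> 'a \<Rightarrow> 'a \<Rightarrow> real \<Rightarrow> bool" where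
  "reachable_on_edge g r h x s \<longleftrightarrow>
     reachable_vertex g (r - s) h \<or> reachable_vertex g (r - (1 - s)) (h \<otimes> x)"

definition reachable :: "'a \<Rightarrow> real \<Rightarrow> 'a cpoint \<Rightarrow> bool" where
  "reachable g r q =
     (case q of Vertex h \<Rightarrow> reachable_vertex g r h | Inner h x s \<Rightarrow> reachable_on_edge g r h x s)"

lemma reachable_vertex_mono: "reachable_vertex g r h \<Longrightarrow> r \<le> r' \<Longrightarrow> reachable_vertex g r' h"
  by (force simp: reachable_vertex_def)

lemma reachable_vertex_letter:
  assumes "reachable_vertex g r h" "l \<in> X \<times> UNIV"
  shows "reachable_vertex g (r + 1) (h \<otimes> letter_val G l)"
proof -
  obtain w where "w \<in> words X" "end_vertex G (g, w) = h" "real (length w) \<le> r"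
    using assms by (auto simp: reachable_vertex_def)
  then show ?thesis using assms(2) unfolding reachable_vertex_def
    by (intro bexI[of _ "w @ [l]"]) (auto simp: end_vertex_def words_def)
qed

lemma reachable_edge_point:
  assumes "h \<in> carrier G" "x \<in> X" "s \<in> {0..1}"
  shows "reachable g r (edge_point G h x s) \<longleftrightarrow> reachable_on_edge g r h x s"
proof -
  have forward: "reachable_vertex g (r - 1) h \<Longrightarrow> reachable_vertex g r (h \<otimes> x)"
    using reachable_vertex_letter[of g "r - 1" h "(x, True)"] assms by (simp add: letter_val_def)
  have x: "x \<in> carrier G" using assms X_subset by auto
  have backward: "reachable_vertex g (r - 1) (h \<otimes> x) \<Longrightarrow> reachable_vertex g r h"
    using reachable_vertex_letter[of g "r - 1" "h \<otimes> x" "(x, False)"] assms x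
    by (simp add: letter_val_def m_assoc)
  show ?thesis
    using forward backward by (auto simp: reachable_def reachable_on_edge_def edge_point_def)
qed

lemma reachable_on_edge_move:
  "reachable_on_edge g r h x s \<Longrightarrow> reachable_on_edge g (r + \<bar>t - s\<bar>) h x t"
  unfolding reachable_on_edge_def
  by (elim disjE) (rule disjI1 disjI2, erule reachable_vertex_mono, argo)+

lemma reachable_pl_path:
  assumes "pl_path G X (Vertex g) r q"
  shows "reachable g r q"
  using assms
proof (induction rule: pl_path.induct)
  case start
  show ?case by (auto simp: reachable_def reachable_vertex_def intro!: bexI[of _ "[]"])
next
  case (segment r h x s t)
  then show ?case using reachable_edge_point reachable_on_edge_move by simp
qed

lemma word_near_cdist:
  assumes "g \<in> carrier G" "h \<in> carrier G"
  obtains w where "w \<in> words X" "end_vertex G (g, w) = h"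
    "real (length w) \<le> cdist (Vertex g) (Vertex h) + 1"
proof -
  obtain r where r: "pl_path G X (Vertex g) r (Vertex h)" "r < cdist (Vertex g) (Vertex h) + 1"
    using pl_path_near_cdist[OF Vertex_in_points[OF assms(1)] Vertex_in_points[OF assms(2)], of 1] by auto
  from reachable_pl_path[OF r(1)] r(2) that show thesis
    by (force simp: reachable_def reachable_vertex_def)
qed

section \<open>Fellow travelling at integer times\<close>

lemma path_at_near_vertex:
  assumes p: "p \<in> cpaths G X" and "t \<ge> 0"
  shows "path_at G p t \<in> points"
    and "cdist (path_at G p t) (Vertex (path_vertex G p (nat \<lfloor>t\<rfloor>))) \<le> 1"
proof -
  have "path_at G p t \<in> points \<and> cdist (path_at G p t) (Vertex (path_vertex G p (nat \<lfloor>t\<rfloor>))) \<le> 1"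
  proof (cases "t < real (plength p)")
    case False
    then have "plength p \<le> nat \<lfloor>t\<rfloor>" by linarith
    then have eq: "path_at G p t = Vertex (path_vertex G p (nat \<lfloor>t\<rfloor>))"
      using False by (simp add: path_at_def path_vertex_end)
    have "Vertex (path_vertex G p (nat \<lfloor>t\<rfloor>)) \<in> points"
      by (intro Vertex_in_points path_vertex_closed p)
    with cdist_le[OF pl_path.start[OF this]] eq show ?thesis by simp
  next
    case True
    define i where "i = nat \<lfloor>t\<rfloor>"
    define v where "v = path_vertex G p i"
    obtain x e where xe: "snd p ! i = (x, e)" by force
    have i: "i < length (snd p)" using True assms(2) unfolding i_def plength_def by linarith
    then have "snd p ! i \<in> X \<times> UNIV" using p by (auto simp: cpaths_def words_def)
    then have x: "x \<in> X" "x \<in> carrier G" using xe X_subset by auto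
    have s: "t - real i \<in> {0..1}" using assms(2) unfolding i_def by auto linarith+
    have v: "v \<in> carrier G" unfolding v_def by (rule path_vertex_closed[OF p])
    have at: "path_at G p t =
        (if e then edge_point G v x (t - real i) else edge_point G (v \<otimes> inv x) x (1 - (t - real i)))"
      using True xe by (simp add: path_at_def i_def v_def path_vertex_def Let_def)
    \<comment> \<open>the current point and the last vertex lie on one closed edge, whose initial vertex is the last
      vertex if the letter is a generator and the next one if it is an inverse\<close>
    have "\<exists>h\<in>carrier G. \<exists>a\<in>{0..1}. \<exists>b\<in>{0..1}.
        path_at G p t = edge_point G h x a \<and> Vertex v = edge_point G h x b"
    proof (cases e)
      case True
      then show ?thesis using at s v
        by (intro bexI[of _ v] bexI[of _ "t - real i"] bexI[of _ 0]) (auto simp: edge_point_def)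
    next
      case False
      then show ?thesis using at s v x
        by (intro bexI[of _ "v \<otimes> inv x"] bexI[of _ "1 - (t - real i)"] bexI[of _ 1])
           (auto simp: edge_point_def m_assoc)
    qed
    then obtain h a b where h: "h \<in> carrier G" "a \<in> {0..1}" "b \<in> {0..1}"
      "path_at G p t = edge_point G h x a" "Vertex v = edge_point G h x b" by auto
    have "cdist (path_at G p t) (Vertex v) \<le> \<bar>b - a\<bar>"
      using cdist_le[OF pl_path_edge[OF h(1) x(1) h(2,3)]] h by simp
    moreover have "\<bar>b - a\<bar> \<le> 1" using h(2,3) by auto
    ultimately show ?thesis
      using edge_point_in_points[OF h(1) x(1) h(2)] h(4) by (simp add: v_def i_def)
  qed
  then show "path_at G p t \<in> points"
    and "cdist (path_at G p t) (Vertex (path_vertex G p (nat \<lfloor>t\<rfloor>))) \<le> 1" by auto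
qed

abbreviation vdist :: "'a \<Rightarrow> 'a \<Rightarrow> real" where
  "vdist g h \<equiv> cdist (Vertex g) (Vertex h)"

lemma vdist_triangle:
  "g \<in> carrier G \<Longrightarrow> h \<in> carrier G \<Longrightarrow> j \<in> carrier G \<Longrightarrow> vdist g j \<le> vdist g h + vdist h j"
  by (intro cdist_triangle Vertex_in_points)

text \<open>A point of a path is within distance \<open>1\<close> of the last vertex passed, so comparing vertices
  instead of points changes the fellow travelling constant by at most \<open>2\<close>, in either direction.\<close>

lemma fellow_travel_vertices:
  assumes p: "p \<in> cpaths G X" and q: "q \<in> cpaths G X"
    and k: "\<And>i. vdist (path_vertex G p i) (path_vertex G q i) \<le> k"
  shows "fellow_travel G X (k + 2) p q"
  unfolding fellow_travel_def
proof (intro allI impI)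
  fix t :: real assume "t \<ge> 0"
  note P = path_at_near_vertex[OF p this] and Q = path_at_near_vertex[OF q this]
  let ?p = "Vertex (path_vertex G p (nat \<lfloor>t\<rfloor>))" and ?q = "Vertex (path_vertex G q (nat \<lfloor>t\<rfloor>))"
  have pts: "?p \<in> points" "?q \<in> points"
    using p q by (auto intro!: Vertex_in_points path_vertex_closed)
  have "cdist (path_at G p t) (path_at G q t) \<le> cdist (path_at G p t) ?p + cdist ?p (path_at G q t)"
    by (intro cdist_triangle P pts Q)
  moreover have "cdist ?p (path_at G q t) \<le> cdist ?p ?q + cdist ?q (path_at G q t)"
    by (intro cdist_triangle pts Q)
  ultimately show "cdist (path_at G p t) (path_at G q t) \<le> k + 2"
    using P(2) Q(2) k[of "nat \<lfloor>t\<rfloor>"] cdist_sym[of ?q] by simp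
qed

lemma async_fellow_travel_vertices:
  assumes p: "p \<in> cpaths G X" and q: "q \<in> cpaths G X" and "async_fellow_travel G X k p q"
  obtains f :: "nat \<Rightarrow> nat" where "\<And>i j. i \<le> j \<Longrightarrow> f i \<le> f j" "\<And>i. f i \<le> plength q"
    "\<And>i. vdist (path_vertex G p i) (path_vertex G q (f i)) \<le> k + 2"
proof -
  obtain \<phi> :: "real \<Rightarrow> real" where \<phi>: "\<phi> \<in> {0..} \<rightarrow> {0..}" "mono_on {0..} \<phi>"
    "\<And>t. t \<ge> 0 \<Longrightarrow> cdist (path_at G p t) (path_at G q (\<phi> t)) \<le> k"
    using assms(3) unfolding async_fellow_travel_def by blast
  \<comment> \<open>the path \<open>q\<close> rests at its endpoint from time \<open>plength q\<close> on, so the cut-off moves no point\<close>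
  define f where "f = (\<lambda>i::nat. min (plength q) (nat \<lfloor>\<phi> i\<rfloor>))"
  show thesis
  proof (rule that[of f])
    fix i j :: nat assume "i \<le> j"
    then have "\<phi> i \<le> \<phi> j" using \<phi>(2) by (auto simp: mono_on_def)
    then have "nat \<lfloor>\<phi> i\<rfloor> \<le> nat \<lfloor>\<phi> j\<rfloor>" by (intro nat_mono floor_mono)
    then show "f i \<le> f j" unfolding f_def by linarith
  next
    fix i :: nat
    show "f i \<le> plength q" by (simp add: f_def)
    have "\<phi> i \<ge> 0" using \<phi>(1) by auto
    note P = path_at_near_vertex[OF p, of "real i"] and Q = path_at_near_vertex[OF q this]
    have "path_vertex G q (f i) = path_vertex G q (nat \<lfloor>\<phi> i\<rfloor>)"
      by (simp add: f_def path_vertex_def plength_def min_def)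
    then have Q2: "cdist (path_at G q (\<phi> i)) (Vertex (path_vertex G q (f i))) \<le> 1"
      using Q(2) by simp
    have pts: "Vertex (path_vertex G p i) \<in> points" "Vertex (path_vertex G q (f i)) \<in> points"
      using p q by (auto intro!: Vertex_in_points path_vertex_closed)
    have "vdist (path_vertex G p i) (path_vertex G q (f i))
        \<le> cdist (Vertex (path_vertex G p i)) (path_at G p i)
           + cdist (path_at G p i) (Vertex (path_vertex G q (f i)))"
      using P by (intro cdist_triangle pts) auto
    moreover have "cdist (path_at G p i) (Vertex (path_vertex G q (f i)))
        \<le> cdist (path_at G p i) (path_at G q (\<phi> i))
           + cdist (path_at G q (\<phi> i)) (Vertex (path_vertex G q (f i)))"
      using P by (intro cdist_triangle pts Q) auto
    moreover have "cdist (Vertex (path_vertex G p i)) (path_at G p i) \<le> 1"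
      using P(2) cdist_sym[of "Vertex (path_vertex G p i)"] by simp
    ultimately show "vdist (path_vertex G p i) (path_vertex G q (f i)) \<le> k + 2"
      using Q2 \<phi>(3)[of i] by simp
  qed
qed

lemma vdist_path_vertex:
  assumes p: "p \<in> cpaths G X" and "i \<le> j + c" "j \<le> i + c"
  shows "vdist (path_vertex G p i) (path_vertex G p j) \<le> real c"
proof -
  have "vdist (path_vertex G p i) (path_vertex G p j) \<le> real (j - i)" if "i \<le> j" for i j
  proof -
    have w: "take (j - i) (drop i (snd p)) \<in> words X"
      using p by (auto simp: cpaths_def intro!: words_take words_drop)
    have "path_vertex G p j = end_vertex G (path_vertex G p i, take (j - i) (drop i (snd p)))"
      using that by (simp add: path_vertex_def flip: end_vertex_append take_add)
    then have "vdist (path_vertex G p i) (path_vertex G p j) \<le> length (take (j - i) (drop i (snd p)))"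
      using cdist_le[OF pl_path_word[OF path_vertex_closed[OF p] w]] by simp
    then show ?thesis by simp
  qed
  from this[of i j] this[of j i] assms(2,3) show ?thesis
    using cdist_sym[of "Vertex (path_vertex G p i)" "Vertex (path_vertex G p j)"]
    by (cases "i \<le> j") auto
qed

section \<open>Synchronizing a shorter loop\<close>

text \<open>The loop that leaves \<open>w\<close> at time \<open>s\<close>, shortcuts through \<open>u\<close> and returns to \<open>w\<close> at time \<open>t\<close>.
  It runs ahead of \<open>w\<close> or behind it by at most \<open>C + 2 * B\<close>: the drift accounts for \<open>C\<close>, the bridges
  for \<open>2 * B\<close>.\<close>

lemma shortcut_loop:
  fixes f :: "nat \<Rightarrow> nat"
  assumes w: "w \<in> cloops G X" and u: "u \<in> cpaths G X"
    and f: "\<And>i j. i \<le> j \<Longrightarrow> f i \<le> f j" "\<And>i. f i \<le> plength u"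
    and near: "\<And>i. vdist (path_vertex G w i) (path_vertex G u (f i)) + 1 \<le> real B"
    and st: "s \<le> t" "t \<le> plength w" "t + f s = s + f t + C" and C: "2 * B < C"
    and drift: "\<And>i. s \<le> i \<Longrightarrow> i \<le> t \<Longrightarrow> i + f s \<le> s + f i + C \<and> s + f i \<le> i + f s"
  obtains v where "v \<in> cloops G X" "fst v = fst w" "plength v < plength w"
    "\<And>i. vdist (path_vertex G w i) (path_vertex G v i) \<le> real (C + 2 * B)"
proof -
  obtain g a where wa: "w = (g, a)" by force
  obtain h c where uc: "u = (h, c)" by force
  have wp: "w \<in> cpaths G X" using w by (simp add: cloops_def)
  have ga: "g \<in> carrier G" "a \<in> words X" and c: "c \<in> words X"
    using wp u by (auto simp: wa uc cpaths_def)
  note W = path_vertex_closed[OF wp] and U = path_vertex_closed[OF u]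
  obtain b where b: "b \<in> words X" "end_vertex G (path_vertex G w s, b) = path_vertex G u (f s)"
    "length b \<le> B"
    using word_near_cdist[OF W[of s] U[of "f s"]] near[of s] by (smt (verit) of_nat_le_iff)
  obtain b' where b': "b' \<in> words X" "end_vertex G (path_vertex G u (f t), b') = path_vertex G w t"
    "length b' \<le> B"
    using word_near_cdist[OF U[of "f t"] W[of t]] near[of t]
      cdist_sym[of "Vertex (path_vertex G w t)" "Vertex (path_vertex G u (f t))"]
    by (smt (verit) of_nat_le_iff)
  \<comment> \<open>\<open>x1\<close>, \<open>x2\<close>, \<open>x3\<close> are the prefixes of the new loop ending where it reaches \<open>u\<close>,
    leaves \<open>u\<close> and rejoins \<open>w\<close>\<close>
  define m where "m = take (f t - f s) (drop (f s) c)"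
  define x1 where "x1 = take s a @ b"
  define x2 where "x2 = x1 @ m"
  define x3 where "x3 = x2 @ b'"
  define v where "v = (g, x3 @ drop t a)"
  have fst_le: "f s \<le> f t" using f(1) st(1) .
  have len_m: "length m = f t - f s"
    using f(2)[of t] fst_le by (simp add: m_def uc plength_def)
  have len1: "length x1 = s + length b" using st by (simp add: x1_def wa plength_def)
  have len3: "length x3 = s + length b + (f t - f s) + length b'"
    by (simp add: x3_def x2_def len1 len_m)
  have e1: "end_vertex G (g, x1) = path_vertex G u (f s)"
    using b(2) by (simp add: x1_def end_vertex_append path_vertex_def wa)
  have mid: "path_vertex G (end_vertex G (g, x1), m) j = path_vertex G u (f s + j)"
    if "j \<le> f t - f s" for j
    using that path_vertex_drop[of G h c "f s" j] unfolding e1 m_def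
    by (simp add: path_vertex_take uc)
  have e2: "end_vertex G (g, x2) = path_vertex G u (f t)"
    using mid[of "f t - f s"] len_m fst_le path_vertex_end[of "(end_vertex G (g, x1), m)" "f t - f s" G]
    by (simp add: x2_def end_vertex_append plength_def)
  have e3: "end_vertex G (g, x3) = path_vertex G w t"
    using b'(2) e2 by (simp add: x3_def end_vertex_append)
  have "end_vertex G v = end_vertex G w"
    using e3 end_vertex_append[of G g "take t a" "drop t a"]
    by (simp add: v_def end_vertex_append path_vertex_def wa)
  moreover have vp: "v \<in> cpaths G X"
    using ga b b' c
    by (simp add: v_def cpaths_def x1_def x2_def x3_def m_def words_take words_drop)
  ultimately have loop: "v \<in> cloops G X" using w by (simp add: cloops_def v_def wa)
  have shorter: "plength v < plength w"
    using len3 st C b(3) b'(3) fst_le by (simp add: v_def wa plength_def)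
  note V = path_vertex_closed[OF vp]
  have v1: "path_vertex G v i = path_vertex G w i" if "i \<le> s" for i
  proof -
    have "i \<le> length (take s a)" using that st by (simp add: wa plength_def)
    then show ?thesis using that
      by (simp add: v_def x3_def x2_def x1_def wa path_vertex_append_left path_vertex_take)
  qed
  have v2: "path_vertex G v (length x1 + j) = path_vertex G u (f s + j)" if "j \<le> f t - f s" for j
  proof -
    have "path_vertex G v (length x1 + j) = path_vertex G (end_vertex G (g, x1), m @ b' @ drop t a) j"
      by (simp add: v_def x3_def x2_def path_vertex_append_right)
    also have "\<dots> = path_vertex G (end_vertex G (g, x1), m) j"
      using that len_m by (simp add: path_vertex_append_left)
    finally show ?thesis using mid[OF that] by simp
  qed
  have v3: "path_vertex G v (length x3 + j) = path_vertex G w (t + j)" for j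
    by (simp add: v_def path_vertex_append_right e3 wa path_vertex_drop)
  have "vdist (path_vertex G w i) (path_vertex G v i) \<le> real (C + 2 * B)" for i
  proof -
    consider "i \<le> s" | "s \<le> i" "i \<le> t" | "t \<le> i" by linarith
    then show ?thesis
    proof cases
      case 1
      then show ?thesis
        using vdist_path_vertex[OF wp, of i i "C + 2 * B"] v1 by simp
    next
      case 2
      \<comment> \<open>compare with the time at which the new loop passes the partner \<open>f i\<close> of \<open>i\<close> on \<open>u\<close>\<close>
      have fi: "f s \<le> f i" "f i \<le> f t" using f(1) 2 by auto
      have "vdist (path_vertex G v (length x1 + (f i - f s))) (path_vertex G v i) \<le> real (C + B)"
        using drift[OF 2] fi b(3) len1 by (intro vdist_path_vertex vp) linarith+
      moreover have "path_vertex G v (length x1 + (f i - f s)) = path_vertex G u (f i)"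
        using v2[of "f i - f s"] fi by simp
      ultimately show ?thesis
        using near[of i] vdist_triangle[OF W[of i] U[of "f i"] V[of i]] by simp
    next
      case 3
      then have "path_vertex G w i = path_vertex G v (length x3 + (i - t))" using v3[of "i - t"] by simp
      moreover have "vdist (path_vertex G v (length x3 + (i - t))) (path_vertex G v i) \<le> real (C + 2 * B)"
        using 3 st fst_le b(3) b'(3) len3 by (intro vdist_path_vertex vp) linarith+
      ultimately show ?thesis by simp
    qed
  qed
  then show thesis using that loop shorter by (simp add: v_def wa)
qed

text \<open>The length of a bridge is at most \<open>k + 3\<close>: the constant \<open>k\<close>, plus \<open>2\<close> for passing from points to
  vertices, plus \<open>1\<close> for choosing a word of nearly minimal length.  With \<open>C = 2 * B + 1\<close> the bound
  \<open>C + 2 * B\<close> of the shortcut becomes \<open>4 * B + 1\<close>, and passing back to points costs another \<open>2\<close>.\<close>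

lemma synchronize:
  assumes w: "w \<in> cloops G X" and u: "u \<in> cloops G X" and "plength u < plength w"
    and async: "async_fellow_travel G X k w u" and B: "k + 3 \<le> real B"
  obtains v where "v \<in> cloops G X" "fst v = fst u \<or> fst v = fst w" "plength v < plength w"
    "fellow_travel G X (real (4 * B + 3)) w v"
proof -
  have wp: "w \<in> cpaths G X" and up: "u \<in> cpaths G X" using w u by (auto simp: cloops_def)
  obtain f :: "nat \<Rightarrow> nat" where f: "\<And>i j. i \<le> j \<Longrightarrow> f i \<le> f j" "\<And>i. f i \<le> plength u"
    and near: "\<And>i. vdist (path_vertex G w i) (path_vertex G u (f i)) \<le> k + 2"
    by (rule async_fellow_travel_vertices[OF wp up async]) blast
  have nearB: "vdist (path_vertex G w i) (path_vertex G u (f i)) + 1 \<le> real B" for i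
    using near[of i] B by linarith
  have travel: "fellow_travel G X (real (4 * B + 3)) w v" if "v \<in> cloops G X"
    "\<And>i. vdist (path_vertex G w i) (path_vertex G v i) \<le> real (4 * B + 1)" for v
    using fellow_travel_vertices[OF wp _ that(2)] that(1) by (simp add: cloops_def add.commute)
  consider
    (bounded) "\<And>s t. s \<le> t \<Longrightarrow> t \<le> plength w \<Longrightarrow> t + f s \<le> s + f t + (2 * B + 1)"
  | (drop) s t where "s \<le> t" "t \<le> plength w" "t + f s = s + f t + (2 * B + 1)"
      "\<And>i. s \<le> i \<Longrightarrow> i \<le> t \<Longrightarrow> i + f s \<le> s + f i + (2 * B + 1) \<and> s + f i \<le> i + f s"
    by (rule drift_dichotomy[of f "2 * B + 1" "plength w"]) (use f(1) in auto)
  then show thesis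
  proof cases
    case bounded
    have early: "vdist (path_vertex G w i) (path_vertex G u i) \<le> real (3 * B + 1)" if "i \<le> plength w" for i
    proof -
      \<comment> \<open>the drift is nonnegative at time \<open>0\<close> and negative at time \<open>plength w\<close>\<close>
      have "vdist (path_vertex G u (f i)) (path_vertex G u i) \<le> real (2 * B + 1)"
        using bounded[of 0 i] bounded[of i "plength w"] that f(2)[of "plength w"] assms(3)
        by (intro vdist_path_vertex up) linarith+
      then show ?thesis
        using nearB[of i] vdist_triangle[OF path_vertex_closed[OF wp, of i]
            path_vertex_closed[OF up, of "f i"] path_vertex_closed[OF up, of i]]
        by simp
    qed
    have "vdist (path_vertex G w i) (path_vertex G u i) \<le> real (4 * B + 1)" for i
    proof (cases "i \<le> plength w")
      case True
      then show ?thesis using early[of i] by simp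
    next
      case False
      \<comment> \<open>both paths have come to rest\<close>
      then show ?thesis
        using early[of "plength w"] assms(3)
        by (simp add: path_vertex_end)
    qed
    then show thesis using that[of u] travel[of u] u assms(3) by blast
  next
    case (drop s t)
    obtain v where "v \<in> cloops G X" "fst v = fst w" "plength v < plength w"
      "\<And>i. vdist (path_vertex G w i) (path_vertex G v i) \<le> real (2 * B + 1 + 2 * B)"
      using shortcut_loop[OF w up f nearB drop(1-3) _ drop(4)] by auto
    then show thesis using that[of v] travel[of v] by simp
  qed
qed

end

lemma fellow_travel_imp_async:
  assumes "fellow_travel G X k w u"
  shows "async_fellow_travel G X k w u"
  unfolding async_fellow_travel_def
  using assms proper_map_id[of "top_of_set {0::real..}"]
  by (intro exI[of _ "\<lambda>t. t"]) (auto simp: fellow_travel_def mono_on_def id_def)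

theorem theorem3p2:
  fixes G :: "('a, 'b) monoid_scheme" and X :: "'a set"
  assumes "group G"
    and "finite X"
    and "X \<subseteq> carrier G"
    and "generate G X = carrier G"
  shows "(async_loop_shortening G X \<longleftrightarrow> loop_shortening G X) \<and>
    (async_basepoint_loop_shortening G X \<longleftrightarrow> basepoint_loop_shortening G X)"
proof -
  interpret cayley_graph G X
    using assms by (simp add: cayley_graph_def cayley_graph_axioms_def)
  define B :: "real \<Rightarrow> nat" where "B k = nat \<lceil>k + 3\<rceil>" for k
  have B: "k + 3 \<le> real (B k)" for k
    unfolding B_def by (rule real_nat_ceiling_ge)
  have sync: "\<exists>v\<in>cloops G X. (fst v = fst u \<or> fst v = fst w) \<and> plength v < plength w \<and>
      fellow_travel G X (real (4 * B k + 3)) w v"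
    if "w \<in> cloops G X" "u \<in> cloops G X" "plength u < plength w" "async_fellow_travel G X k w u"
    for w u k
    by (rule synchronize[OF that B]) blast
  have pos: "real (4 * B k + 3) > 0" for k by simp
  have "loop_shortening G X" if "async_loop_shortening G X"
  proof -
    obtain k where k: "\<forall>w\<in>cloops G X. plength w > 0 \<longrightarrow>
        (\<exists>u\<in>cloops G X. plength u < plength w \<and> async_fellow_travel G X k w u)"
      using \<open>async_loop_shortening G X\<close> unfolding async_loop_shortening_def by blast
    have "\<exists>v\<in>cloops G X. plength v < plength w \<and> fellow_travel G X (real (4 * B k + 3)) w v"
      if "w \<in> cloops G X" "plength w > 0" for w
      using k that sync by blast
    with pos show ?thesis unfolding loop_shortening_def by blast
  qed
  moreover have "basepoint_loop_shortening G X" if "async_basepoint_loop_shortening G X"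
  proof -
    obtain k where k: "\<forall>w\<in>cloops G X. plength w > 0 \<longrightarrow>
        (\<exists>u\<in>cloops G X. fst u = fst w \<and> plength u < plength w \<and> async_fellow_travel G X k w u)"
      using \<open>async_basepoint_loop_shortening G X\<close>
      unfolding async_basepoint_loop_shortening_def by blast
    have "\<exists>v\<in>cloops G X. fst v = fst w \<and> plength v < plength w \<and>
        fellow_travel G X (real (4 * B k + 3)) w v"
      if w: "w \<in> cloops G X" "plength w > 0" for w
    proof -
      obtain u where u: "u \<in> cloops G X" "fst u = fst w" "plength u < plength w"
        "async_fellow_travel G X k w u"
        using k w by blast
      from sync[OF w(1) u(1,3,4)] u(2) show ?thesis by simp
    qed
    with pos show ?thesis unfolding basepoint_loop_shortening_def by blast
  qed
  moreover have "loop_shortening G X \<Longrightarrow> async_loop_shortening G X"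
    unfolding loop_shortening_def async_loop_shortening_def
    using fellow_travel_imp_async by blast
  moreover have "basepoint_loop_shortening G X \<Longrightarrow> async_basepoint_loop_shortening G X"
    unfolding basepoint_loop_shortening_def async_basepoint_loop_shortening_def
    using fellow_travel_imp_async by blast
  ultimately show ?thesis by blast
qed

end
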